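(* Let $0\le p<\tfrac12$. Consider, for each $K\ge 1$, the binary-symmetric parallel-relay (BSPR) network with $K$ relays, with cross-over probabilities $p_{s,i},p_{i,d}\in[0,\tfrac12]$ such that $p_i:=p_{s,i}(1-p_{i,d})+(1-p_{s,i})p_{i,d}=p$ for all $i\in\{1,\dots,K\}$. Using uncoded transmission at the source and forwarding relays, the asymptotic capacity of $1$ bit per channel use is achievable with a sufficiently large number of relays. That is: for every $\epsilon>0$ there is $K_0$ such that for every $K\ge K_0$ there is a decoding function $g:\{0,1\}^K\to\{0,1\}$ with $$\Pr\{g(Y_1,\dots,Y_K)\ne W\}<\epsilon ,$$ where $W$ is the source bit, uniform on $\{0,1\}$, sent uncoded (one new bit per channel use, i.e. at rate $1$), and $Y_1,\dots,Y_K$ are the destination's received signals corresponding to that bit.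
   Context: **The BSPR network.** There is one source, $K$ relays $1,\dots,K$, and one destination. All variables are binary, and $\oplus$ is addition modulo 2. At each time $t$ the source transmits $U[t]$ and relay $i$ receives $V_i[t]=U[t]\oplus Z_i[t]$ with $\Pr\{Z_i[t]=1\}=p_{s,i}$; relay $i$ transmits $X_i[t]$ and the destination receives, on a separate link for each $i$, $Y_i[t]=X_i[t]\oplus E_i[t]$ with $\Pr\{E_i[t]=1\}=p_{i,d}$. All the noises $Z_i[t],E_i[t]$ are independent of each other and of the source bits. **Forwarding relays.** Relay $i$ is a forwarding relay if $X_i[t]=V_i[t-1]$ for all $t$. **Uncoded transmission.** The source sends its uniformly distributed message bits directly, $U=W$, one fresh bit per channel use (rate 1). With forwarding relays, dropping time indices, the signals received by the destination for the bit $W$ are $Y_i=W\oplus Z_i\oplus E_i$, $i=1,\dots,K$, with $\Pr\{Z_i\oplus E_i=1\}=p_i$. The value $1$ bit per channel use is an upper bound on the capacity of the network for every $K$, since the source input is binary; "the asymptotic capacity of 1 bit per channel use is achievable with a sufficiently large number of relays" means that at rate $1$ the error probability of the source bit can be made smaller than any $\epsilon>0$ for all sufficiently large $K$. *)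

theory Defs
  imports "HOL-Probability.Probability" "HOL-Library.Z2"
begin

text \<open>
  Relays are indexed by \<open>i \<in> {1..K}\<close>, channel uses by \<open>t :: nat\<close>. In \<open>Z i t\<close>, \<open>V i t\<close>,
  \<open>X i t\<close>, \<open>E i t\<close>, \<open>Y i t\<close> the first argument is the relay and the second the time;
  addition on type \<open>bit\<close> is addition modulo 2. \<open>W t\<close> are the message bits of the source and
  \<open>U t\<close> its channel inputs.
\<close>

datatype primitive_index = Message nat | Relay_Noise nat nat | Dest_Noise nat nat

definition primitive_indices :: "nat \<Rightarrow> primitive_index set" where
  "primitive_indices K =
     range Message \<union> {Relay_Noise i t | i t. i \<in> {1..K}} \<union> {Dest_Noise i t | i t. i \<in> {1..K}}"

primrec primitive_var ::
  "(nat \<Rightarrow> 'a \<Rightarrow> bit) \<Rightarrow> (nat \<Rightarrow> nat \<Rightarrow> 'a \<Rightarrow> bit) \<Rightarrow> (nat \<Rightarrow> nat \<Rightarrow> 'a \<Rightarrow> bit)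
     \<Rightarrow> primitive_index \<Rightarrow> 'a \<Rightarrow> bit" where
  "primitive_var W Z E (Message t) = W t"
| "primitive_var W Z E (Relay_Noise i t) = Z i t"
| "primitive_var W Z E (Dest_Noise i t) = E i t"

text \<open>
  The assumption \<open>indep\<close> says at once that the message bits are fresh in every channel use, that
  the noises are independent of each other, and that they are independent of the message bits.
\<close>

locale bspr_network = prob_space M
  for M :: "'a measure" +
  fixes K :: nat
    and ps pd :: "nat \<Rightarrow> real"
    and W U :: "nat \<Rightarrow> 'a \<Rightarrow> bit"
    and Z V X E Y :: "nat \<Rightarrow> nat \<Rightarrow> 'a \<Rightarrow> bit"
  assumes indep:
      "indep_vars (\<lambda>_. count_space UNIV) (primitive_var W Z E) (primitive_indices K)"
    and U_rv: "\<And>t. random_variable (count_space UNIV) (U t)"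
    and X_rv: "\<And>i t. i \<in> {1..K} \<Longrightarrow> random_variable (count_space UNIV) (X i t)"
    and Z_prob: "\<And>i t. i \<in> {1..K} \<Longrightarrow> \<P>(\<omega> in M. Z i t \<omega> = 1) = ps i"
    and E_prob: "\<And>i t. i \<in> {1..K} \<Longrightarrow> \<P>(\<omega> in M. E i t \<omega> = 1) = pd i"
    and V_eq: "\<And>i t \<omega>. i \<in> {1..K} \<Longrightarrow> \<omega> \<in> space M \<Longrightarrow> V i t \<omega> = U t \<omega> + Z i t \<omega>"
    and Y_eq: "\<And>i t \<omega>. i \<in> {1..K} \<Longrightarrow> \<omega> \<in> space M \<Longrightarrow> Y i t \<omega> = X i t \<omega> + E i t \<omega>"

text \<open>
  Time starts at 0, so a forwarding relay's very first output \<open>X i 0\<close>, sent before anything has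
  been received, is left arbitrary. Because of the one-step delay, the signals belonging to the
  message bit \<open>W t\<close> are the \<open>Y i (Suc t)\<close>.
\<close>

locale uncoded_forwarding_bspr = bspr_network +
  assumes message_uniform: "\<And>t b. \<P>(\<omega> in M. W t \<omega> = b) = 1 / 2"
    and uncoded: "\<And>t \<omega>. \<omega> \<in> space M \<Longrightarrow> U t \<omega> = W t \<omega>"
    and forwarding:
      "\<And>i t \<omega>. i \<in> {1..K} \<Longrightarrow> \<omega> \<in> space M \<Longrightarrow> X i (Suc t) \<omega> = V i t \<omega>"

end

theory Submission
  imports Defs
begin

text \<open>
  The destination takes the majority of the \<open>K\<close> received bits. A wrong decision forces at least
  half of the end-to-end noises \<open>Z i t + E i (Suc t)\<close> to equal 1. These are independent Bernoulli
  variables of mean \<open>p < 1 / 2\<close>, so Hoeffding's inequality bounds the error probability by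
  \<open>exp (- 2 * K * (1 / 2 - p)\<^sup>2)\<close>, which tends to 0.
\<close>

text \<open>Splitting on the value of \<open>f x\<close> turns the sum into a conditional between
  two measurable functions.\<close>

lemma measurable_bit_add [measurable (raw)]:
  fixes f g :: "'a \<Rightarrow> bit"
  assumes [measurable]: "f \<in> M \<rightarrow>\<^sub>M count_space UNIV" "g \<in> M \<rightarrow>\<^sub>M count_space UNIV"
  shows "(\<lambda>x. f x + g x) \<in> M \<rightarrow>\<^sub>M count_space UNIV"
proof -
  have [measurable]: "(\<lambda>x. 1 + g x) \<in> M \<rightarrow>\<^sub>M count_space UNIV"
    using assms(2) by (rule measurable_compose) simp
  have "f x + g x = (if f x = 0 then g x else 1 + g x)" for x
    by (cases "f x") auto
  then show ?thesis by (simp only:) measurable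
qed

context bspr_network
begin

lemma Z_rv: "i \<in> {1..K} \<Longrightarrow> random_variable (count_space UNIV) (Z i t)"
  and E_rv: "i \<in> {1..K} \<Longrightarrow> random_variable (count_space UNIV) (E i t)"
proof -
  assume i: "i \<in> {1..K}"
  have rv: "random_variable (count_space UNIV) (primitive_var W Z E j)"
    if "j \<in> primitive_indices K" for j
    using indep that by (auto simp: indep_vars_def)
  show "random_variable (count_space UNIV) (Z i t)"
    using rv[of "Relay_Noise i t"] i by (auto simp: primitive_indices_def)
  show "random_variable (count_space UNIV) (E i t)"
    using rv[of "Dest_Noise i t"] i by (auto simp: primitive_indices_def)
qed

lemma link_noise_rv:
  assumes "i \<in> {1..K}"
  shows "random_variable (count_space UNIV) (\<lambda>\<omega>. Z i s \<omega> + E i t \<omega>)"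
proof -
  note [measurable] = Z_rv[OF assms] E_rv[OF assms]
  show ?thesis by measurable
qed

text \<open>Independence of the whole family, applied to two of its members. The times
  \<open>s\<close> and \<open>t\<close> may differ, as they do for the two hops of a delayed
  relay.\<close>

lemma prob_link_noises:
  assumes i: "i \<in> {1..K}"
  shows "\<P>(\<omega> in M. Z i s \<omega> = a \<and> E i t \<omega> = b) = \<P>(\<omega> in M. Z i s \<omega> = a) * \<P>(\<omega> in M. E i t \<omega> = b)"
proof -
  let ?J = "{Relay_Noise i s, Dest_Noise i t}"
  let ?A = "\<lambda>j. case j of Relay_Noise _ _ \<Rightarrow> {a} | _ \<Rightarrow> {b}"
  have "prob (\<Inter>j\<in>?J. primitive_var W Z E j -` ?A j \<inter> space M)
      = (\<Prod>j\<in>?J. prob (primitive_var W Z E j -` ?A j \<inter> space M))"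
    using i by (intro indep_varsD[OF indep]) (auto simp: primitive_indices_def)
  then show ?thesis
    by (simp add: vimage_def Int_def conj_ac)
qed

text \<open>A bit arrives flipped exactly when one of the two hops flips it and the other does not;
  these two cases are disjoint.\<close>

lemma prob_link_noise:
  assumes i: "i \<in> {1..K}"
  shows "\<P>(\<omega> in M. Z i s \<omega> + E i t \<omega> = 1) = ps i * (1 - pd i) + (1 - ps i) * pd i"
proof -
  note [measurable] = Z_rv[OF i] E_rv[OF i]
  have zero: "\<P>(\<omega> in M. f \<omega> = 0) = 1 - \<P>(\<omega> in M. f \<omega> = 1)"
    if [measurable]: "random_variable (count_space UNIV) f" for f :: "'a \<Rightarrow> bit"
    by (subst prob_neg[symmetric]) auto
  have "{\<omega> \<in> space M. Z i s \<omega> + E i t \<omega> = 1}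
      = {\<omega> \<in> space M. Z i s \<omega> = 1 \<and> E i t \<omega> = 0} \<union> {\<omega> \<in> space M. Z i s \<omega> = 0 \<and> E i t \<omega> = 1}"
    (is "_ = ?A \<union> ?B")
  proof -
    have "x + y = 1 \<longleftrightarrow> x = 1 \<and> y = 0 \<or> x = 0 \<and> y = 1" for x y :: bit
      by (cases x; cases y) auto
    then show ?thesis by blast
  qed
  also have "prob \<dots> = prob ?A + prob ?B"
    by (intro finite_measure_Union) auto
  finally show ?thesis
    by (simp add: prob_link_noises[OF i] zero Z_rv[OF i] E_rv[OF i] Z_prob[OF i] E_prob[OF i])
qed

text \<open>Different relays use disjoint blocks of primitive noises, and functions of disjoint
  blocks of an independent family are independent.\<close>

lemma indep_link_noise:
  "indep_vars (\<lambda>_. count_space UNIV) (\<lambda>i \<omega>. Z i s \<omega> + E i t \<omega>) {1..K}"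
proof -
  let ?J = "\<lambda>i. {Relay_Noise i s, Dest_Noise i t}"
  let ?add = "\<lambda>i (x :: primitive_index \<Rightarrow> bit). x (Relay_Noise i s) + x (Dest_Noise i t)"
  \<comment> \<open>Restricting to \<open>?J i\<close> makes each block a random element of the
    product space over \<open>?J i\<close>, on which \<open>?add i\<close> is measurable.\<close>
  have "indep_vars (\<lambda>i. PiM (?J i) (\<lambda>_. count_space UNIV))
          (\<lambda>i \<omega>. restrict (\<lambda>j. primitive_var W Z E j \<omega>) (?J i)) {1..K}"
    by (intro indep_vars_restrict[OF indep]) (auto simp: primitive_indices_def disjoint_family_on_def)
  then have "indep_vars (\<lambda>_. count_space UNIV)
      (\<lambda>i \<omega>. ?add i (restrict (\<lambda>j. primitive_var W Z E j \<omega>) (?J i))) {1..K}"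
  proof (rule indep_vars_compose2)
    fix i
    show "?add i \<in> PiM (?J i) (\<lambda>_. count_space UNIV) \<rightarrow>\<^sub>M count_space UNIV"
      by (intro measurable_bit_add measurable_component_singleton) auto
  qed
  then show ?thesis by simp
qed

text \<open>Stated as a \<open>K\<close>-th power whose base depends on \<open>p\<close> alone, so
  that the bound is a geometric sequence in \<open>K\<close>.\<close>

lemma prob_noisy_majority_le:
  assumes K: "K \<ge> 1" and p: "p < 1 / 2"
    and link: "\<And>i. i \<in> {1..K} \<Longrightarrow> ps i * (1 - pd i) + (1 - ps i) * pd i = p"
  shows "\<P>(\<omega> in M. real K / 2 \<le> (\<Sum>i\<in>{1..K}. of_bool (Z i s \<omega> + E i t \<omega> = 1)))
           \<le> exp (- 2 * (1 / 2 - p)\<^sup>2) ^ K"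
proof -
  define N where "N i \<omega> = (of_bool (Z i s \<omega> + E i t \<omega> = 1) :: real)" for i \<omega>
  have exp_N: "expectation (N i) = p" if i: "i \<in> {1..K}" for i
  proof -
    note [measurable] = link_noise_rv[OF i, of s t]
    have "expectation (N i) = expectation (indicator {\<omega> \<in> space M. Z i s \<omega> + E i t \<omega> = 1})"
      unfolding N_def by (intro Bochner_Integration.integral_cong) (auto simp: indicator_def)
    also have "\<dots> = \<P>(\<omega> in M. Z i s \<omega> + E i t \<omega> = 1)"
      by (simp add: Int_def conj_ac)
    also have "\<dots> = p"
      by (simp only: prob_link_noise[OF i] link[OF i])
    finally show ?thesis .
  qed
  have "indep_vars (\<lambda>_. borel) N {1..K}"
    unfolding N_def by (rule indep_vars_compose2[OF indep_link_noise]) auto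
  then interpret Hoeffding_ineq M "{1..K}" N "\<lambda>_. 0" "\<lambda>_. 1" "\<Sum>i\<in>{1..K}. expectation (N i)"
    by unfold_locales (auto simp: N_def)
  \<comment> \<open>The gap between the threshold \<open>K / 2\<close> and the mean
    \<open>K * p\<close> of the number of flipped bits, positive because
    \<open>p < 1 / 2\<close>.\<close>
  define \<delta> where "\<delta> = real K * (1 / 2 - p)"
  have "prob {\<omega> \<in> space M. (\<Sum>i\<in>{1..K}. expectation (N i)) + \<delta> \<le> (\<Sum>i\<in>{1..K}. N i \<omega>)}
      \<le> exp (- 2 * \<delta>\<^sup>2 / (\<Sum>i\<in>{1..K}. (1 - 0)\<^sup>2))"
    using K p by (intro Hoeffding_ineq_ge) (auto simp: \<delta>_def)
  also have "(\<Sum>i\<in>{1..K}. expectation (N i)) + \<delta> = real K / 2"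
    by (simp add: exp_N \<delta>_def algebra_simps)
  also have "- 2 * \<delta>\<^sup>2 / (\<Sum>i\<in>{1..K}. (1 - 0)\<^sup>2) = real K * (- 2 * (1 / 2 - p)\<^sup>2)"
    using K by (simp add: \<delta>_def power_mult_distrib power2_eq_square)
  finally show ?thesis
    by (simp only: N_def exp_of_nat_mult)
qed

end

text \<open>The strict inequality decodes a tie, possible only for even \<open>K\<close>, to
  0.\<close>

definition majority :: "nat \<Rightarrow> (nat \<Rightarrow> bit) \<Rightarrow> bit" where
  "majority K y = of_bool (real K / 2 < (\<Sum>i\<in>{1..K}. of_bool (y i = 1)))"

text \<open>For \<open>w = 0\<close> the received ones are the flips. For \<open>w = 1\<close> they
  are the non-flips, so at most half of them means at least half flips; a tie is then an error,
  hence the non-strict bound.\<close>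

lemma majority_add_ne:
  assumes "majority K (\<lambda>i\<in>{1..K}. w + n i) \<noteq> w"
  shows "real K / 2 \<le> (\<Sum>i\<in>{1..K}. of_bool (n i = 1))"
proof (cases w)
  case zero
  then show ?thesis
    using assms by (auto simp: majority_def split: if_splits)
next
  case one
  have "(\<Sum>i\<in>{1..K}. of_bool (1 + n i = 1)) = (\<Sum>i\<in>{1..K}. 1 - of_bool (n i = 1) :: real)"
  proof (rule sum.cong)
    show "of_bool (1 + n i = 1) = (1 - of_bool (n i = 1) :: real)" for i
      by (cases "n i") auto
  qed simp
  then show ?thesis
    using assms one by (auto simp: majority_def sum_subtractf split: if_splits)
qed

lemma (in uncoded_forwarding_bspr) prob_majority_error_le:
  assumes K: "K \<ge> 1" and p: "p < 1 / 2"
    and link: "\<And>i. i \<in> {1..K} \<Longrightarrow> ps i * (1 - pd i) + (1 - ps i) * pd i = p"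
  shows "\<P>(\<omega> in M. majority K (\<lambda>i\<in>{1..K}. Y i (Suc t) \<omega>) \<noteq> W t \<omega>)
           \<le> exp (- 2 * (1 / 2 - p)\<^sup>2) ^ K"
proof -
  \<comment> \<open>The bit sent at time \<open>t\<close> meets the relay noise at \<open>t\<close>
    and, after the one-step delay, the destination noise at \<open>Suc t\<close>.\<close>
  have Y: "(\<lambda>i\<in>{1..K}. Y i (Suc t) \<omega>) = (\<lambda>i\<in>{1..K}. W t \<omega> + (Z i t \<omega> + E i (Suc t) \<omega>))"
    if "\<omega> \<in> space M" for \<omega>
    using that by (intro restrict_ext) (simp only: Y_eq forwarding V_eq uncoded add.assoc)
  \<comment> \<open>Monotonicity of the measure requires the larger event, a threshold event for a
    sum of these indicators, to be measurable.\<close>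
  have [measurable]: "(\<lambda>\<omega>. of_bool (Z i t \<omega> + E i (Suc t) \<omega> = 1) :: real) \<in> borel_measurable M"
    if "i \<in> {1..K}" for i
    using link_noise_rv[OF that, of t "Suc t"] by (rule measurable_compose) simp
  have "\<P>(\<omega> in M. majority K (\<lambda>i\<in>{1..K}. Y i (Suc t) \<omega>) \<noteq> W t \<omega>)
      \<le> \<P>(\<omega> in M. real K / 2 \<le> (\<Sum>i\<in>{1..K}. of_bool (Z i t \<omega> + E i (Suc t) \<omega> = 1)))"
  proof (rule finite_measure_mono)
    show "{\<omega> \<in> space M. majority K (\<lambda>i\<in>{1..K}. Y i (Suc t) \<omega>) \<noteq> W t \<omega>}
        \<subseteq> {\<omega> \<in> space M. real K / 2 \<le> (\<Sum>i\<in>{1..K}. of_bool (Z i t \<omega> + E i (Suc t) \<omega> = 1))}"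
      using Y majority_add_ne[where n = "\<lambda>i. Z i t \<omega> + E i (Suc t) \<omega>" and w = "W t \<omega>" for \<omega>]
      by (auto simp del: add_bit_eq_xor)
  qed measurable
  also have "\<dots> \<le> exp (- 2 * (1 / 2 - p)\<^sup>2) ^ K"
    by (rule prob_noisy_majority_le[OF assms])
  finally show ?thesis .
qed

text \<open>The restriction to \<open>{1..K}\<close> lets \<open>g\<close> see only the
  \<open>K\<close> received bits, and \<open>g\<close> is chosen before \<open>t\<close>, so one
  decoder serves all channel uses.\<close>

theorem theorem4:
  fixes p :: real
    and M :: "nat \<Rightarrow> 'a measure"
    and ps pd :: "nat \<Rightarrow> nat \<Rightarrow> real"
    and W U :: "nat \<Rightarrow> nat \<Rightarrow> 'a \<Rightarrow> bit"
    and Z V X E Y :: "nat \<Rightarrow> nat \<Rightarrow> nat \<Rightarrow> 'a \<Rightarrow> bit"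
  assumes "0 \<le> p" and "p < 1 / 2"
    and "\<And>K. K \<ge> 1 \<Longrightarrow>
           uncoded_forwarding_bspr (M K) K (ps K) (pd K) (W K) (U K) (Z K) (V K) (X K) (E K) (Y K)"
    and "\<And>K i. K \<ge> 1 \<Longrightarrow> i \<in> {1..K} \<Longrightarrow> ps K i \<in> {0..1 / 2} \<and> pd K i \<in> {0..1 / 2}"
    and "\<And>K i. K \<ge> 1 \<Longrightarrow> i \<in> {1..K} \<Longrightarrow>
           ps K i * (1 - pd K i) + (1 - ps K i) * pd K i = p"
  shows "\<forall>\<epsilon>>0. \<exists>K\<^sub>0\<ge>1. \<forall>K\<ge>K\<^sub>0. \<exists>g :: (nat \<Rightarrow> bit) \<Rightarrow> bit. \<forall>t.
           \<P>(\<omega> in M K. g (\<lambda>i\<in>{1..K}. Y K i (Suc t) \<omega>) \<noteq> W K t \<omega>) < \<epsilon>"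
proof (intro allI impI)
  fix \<epsilon> :: real
  assume "\<epsilon> > 0"
  \<comment> \<open>This base is the same for every \<open>K\<close>, whatever the individual hop
    probabilities, so one threshold can be read off from its powers.\<close>
  let ?q = "exp (- 2 * (1 / 2 - p)\<^sup>2)"
  have "?q < 1"
    using assms(2) by simp
  then have "(\<lambda>K. ?q ^ K) \<longlonglongrightarrow> 0"
    by (intro LIMSEQ_power_zero) simp
  then obtain K\<^sub>0 where K\<^sub>0: "?q ^ K < \<epsilon>" if "K \<ge> K\<^sub>0" for K
    using \<open>\<epsilon> > 0\<close> by (metis (lifting) eventually_sequentially order_tendstoD(2))
  show "\<exists>K\<^sub>0\<ge>1. \<forall>K\<ge>K\<^sub>0. \<exists>g :: (nat \<Rightarrow> bit) \<Rightarrow> bit. \<forall>t.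
          \<P>(\<omega> in M K. g (\<lambda>i\<in>{1..K}. Y K i (Suc t) \<omega>) \<noteq> W K t \<omega>) < \<epsilon>"
  \<comment> \<open>The maximum with 1 ensures that a network is given for every \<open>K\<close>
    considered.\<close>
  proof (intro exI[of _ "max 1 K\<^sub>0"] conjI allI impI)
    fix K
    assume K: "K \<ge> max 1 K\<^sub>0"
    then interpret uncoded_forwarding_bspr "M K" K "ps K" "pd K" "W K" "U K" "Z K" "V K" "X K" "E K" "Y K"
      by (intro assms(3)) simp
    show "\<exists>g :: (nat \<Rightarrow> bit) \<Rightarrow> bit. \<forall>t.
            \<P>(\<omega> in M K. g (\<lambda>i\<in>{1..K}. Y K i (Suc t) \<omega>) \<noteq> W K t \<omega>) < \<epsilon>"
    proof (intro exI[of _ "majority K"] allI)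
      fix t
      have "\<P>(\<omega> in M K. majority K (\<lambda>i\<in>{1..K}. Y K i (Suc t) \<omega>) \<noteq> W K t \<omega>) \<le> ?q ^ K"
        using K assms(2,5) by (intro prob_majority_error_le) auto
      also have "\<dots> < \<epsilon>"
        using K by (intro K\<^sub>0) simp
      finally show "\<P>(\<omega> in M K. majority K (\<lambda>i\<in>{1..K}. Y K i (Suc t) \<omega>) \<noteq> W K t \<omega>) < \<epsilon>" .
    qed
  qed simp
qed

end
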